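(* Let $\Omega\subset\mathbb{R}^2$ be a compact semi-convex region whose boundary $\partial\Omega$ is a Jordan curve, and let $F:\Omega\to\mathbb{R}$ be continuous, non-increasing in its first variable and non-decreasing in its second variable. Suppose that $\mathbf{r}:[0,1]\to\partial\Omega$ is a counterclockwise, piecewise regular parametrization of $\partial\Omega$ such that $f:=F\circ\mathbf{r}$ is differentiable on $[0,1]$ and $f'$ has only finitely many zeros. Then there is a larger rectangular domain (with horizontal and vertical sides) containing $\Omega$ on which $F$ has a nice extension $\widetilde{F}$ that is non-increasing in its first variable and non-decreasing in its second variable.
   Context: A planar region $\Omega$ whose boundary $C=\partial\Omega$ is a simple closed curve is called semi-convex if every horizontal or vertical ray emanating from a point $p\in C$ into the complement $\Omega^c$ does not intersect the curve $C$ again. Here $\Omega$ is the closed region bounded by $C$. A regular curve is a curve whose derivative exists and is non-zero at every point; a curve is piecewise regular if it is a finite concatenation of regular pieces. A continuous function $\widetilde{F}$ on a set containing $\Omega$ is an extension of $F$ if $\widetilde{F}(X)=F(X)$ for all $X\in\Omega$ and $\widetilde{F}$ has the same monotonicity in each variable as $F$. The extension is nice if the range of $\widetilde{F}$ coincides with the range of $F$. *)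

theory Defs
  imports "HOL-Complex_Analysis.Complex_Analysis"
begin

definition jordan_curve :: "(real \<times> real) set \<Rightarrow> bool" where
  "jordan_curve C \<longleftrightarrow>
     (\<exists>c. simple_path c \<and> pathfinish c = pathstart c \<and> path_image c = C)"

text \<open>
  Requiring only that the frontier be a Jordan curve would also admit the curve itself
  (without its interior), hence the second conjunct.
\<close>

definition closed_jordan_region :: "(real \<times> real) set \<Rightarrow> bool" where
  "closed_jordan_region \<Omega> \<longleftrightarrow>
     jordan_curve (frontier \<Omega>) \<and> \<Omega> = frontier \<Omega> \<union> inside (frontier \<Omega>)"

text \<open>
  A ray emanates from \<open>p\<close> \<^emph>\<open>into the complement\<close> if its points close to \<open>p\<close>, other than \<open>p\<close>,
  lie outside \<open>\<Omega>\<close>.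
\<close>

definition semi_convex :: "(real \<times> real) set \<Rightarrow> bool" where
  "semi_convex \<Omega> \<longleftrightarrow>
     (\<forall>p\<in>frontier \<Omega>. \<forall>d\<in>{(1, 0), (-1, 0), (0, 1), (0, -1)}.
        (\<exists>\<epsilon>>0. \<forall>t. 0 < t \<and> t < \<epsilon> \<longrightarrow> p + t *\<^sub>R d \<notin> \<Omega>) \<longrightarrow>
        (\<forall>t>0. p + t *\<^sub>R d \<notin> frontier \<Omega>))"

text \<open>At the end points of the interval the derivative is one-sided.\<close>

definition regular_on :: "real \<Rightarrow> real \<Rightarrow> (real \<Rightarrow> real \<times> real) \<Rightarrow> bool" where
  "regular_on a b r \<longleftrightarrow>
     (\<forall>t\<in>{a..b}. \<exists>v. v \<noteq> 0 \<and> (r has_vector_derivative v) (at t within {a..b}))"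

definition piecewise_regular :: "(real \<Rightarrow> real \<times> real) \<Rightarrow> bool" where
  "piecewise_regular r \<longleftrightarrow>
     (\<exists>(n::nat) (s::nat \<Rightarrow> real). s 0 = 0 \<and> s n = 1 \<and>
        (\<forall>i<n. s i < s (Suc i) \<and> regular_on (s i) (s (Suc i)) r))"

text \<open>To be used for simple closed paths; the plane is identified with \<open>complex\<close>.\<close>

definition counterclockwise :: "(real \<Rightarrow> real \<times> real) \<Rightarrow> bool" where
  "counterclockwise r \<longleftrightarrow>
     (\<forall>(x, y)\<in>inside (path_image r).
        winding_number (\<lambda>t. Complex (fst (r t)) (snd (r t))) (Complex x y) = 1)"

text \<open>
  Monotonicity in one variable, on the sections of \<open>S\<close>. The relation \<open>ord\<close> gives the sense:
  \<open>(\<le>)\<close> means non-decreasing, \<open>(\<ge>)\<close> means non-increasing.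
\<close>

definition monotone_fst ::
    "(real \<Rightarrow> real \<Rightarrow> bool) \<Rightarrow> (real \<times> real) set \<Rightarrow> (real \<times> real \<Rightarrow> real) \<Rightarrow> bool" where
  "monotone_fst ord S G \<longleftrightarrow> (\<forall>y. monotone_on {x. (x, y) \<in> S} (\<le>) ord (\<lambda>x. G (x, y)))"

definition monotone_snd ::
    "(real \<Rightarrow> real \<Rightarrow> bool) \<Rightarrow> (real \<times> real) set \<Rightarrow> (real \<times> real \<Rightarrow> real) \<Rightarrow> bool" where
  "monotone_snd ord S G \<longleftrightarrow> (\<forall>x. monotone_on {y. (x, y) \<in> S} (\<le>) ord (\<lambda>y. G (x, y)))"

text \<open>
  \<open>G\<close> on \<open>D\<close> extends \<open>F\<close> on \<open>\<Omega>\<close>, where \<open>F\<close> has the senses of monotonicity \<open>ord1\<close> and \<open>ord2\<close>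
  in its first and second variable.
\<close>

definition monotone_extension ::
    "(real \<Rightarrow> real \<Rightarrow> bool) \<Rightarrow> (real \<Rightarrow> real \<Rightarrow> bool) \<Rightarrow>
     (real \<times> real) set \<Rightarrow> (real \<times> real \<Rightarrow> real) \<Rightarrow>
     (real \<times> real) set \<Rightarrow> (real \<times> real \<Rightarrow> real) \<Rightarrow> bool" where
  "monotone_extension ord1 ord2 \<Omega> F D G \<longleftrightarrow>
     \<Omega> \<subseteq> D \<and> continuous_on D G \<and> (\<forall>X\<in>\<Omega>. G X = F X) \<and>
     monotone_fst ord1 D G \<and> monotone_snd ord2 D G"

definition nice_extension ::
    "(real \<Rightarrow> real \<Rightarrow> bool) \<Rightarrow> (real \<Rightarrow> real \<Rightarrow> bool) \<Rightarrow>
     (real \<times> real) set \<Rightarrow> (real \<times> real \<Rightarrow> real) \<Rightarrow>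
     (real \<times> real) set \<Rightarrow> (real \<times> real \<Rightarrow> real) \<Rightarrow> bool" where
  "nice_extension ord1 ord2 \<Omega> F D G \<longleftrightarrow>
     monotone_extension ord1 ord2 \<Omega> F D G \<and> G ` D = F ` \<Omega>"

end

theory Submission
  imports Defs
begin

text \<open>
  Semi-convexity means that the horizontal and vertical sections of \<open>\<Omega>\<close> are intervals, and the
  interior \<open>U\<close> of \<open>\<Omega>\<close> inherits this. Since \<open>U\<close> is open and connected, any two of its points are
  joined in \<open>U\<close> by a staircase whose horizontal steps all have one direction and whose vertical
  steps all have one direction. Hence \<open>F\<close> is monotone for the order
  \<open>x' \<le> x \<and> y \<le> y'\<close> of the plane, first on \<open>U\<close> and then by density on \<open>\<Omega>\<close>. A continuous
  function on a compact set that is isotone for this order extends to the whole plane by an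
  asymmetric form of the McShane-Whitney formula.
\<close>

section \<open>Extending isotone functions from compact sets\<close>

text \<open>A compactness argument, playing the role of uniform continuity for the one-sided
  distance \<open>q\<close>. If no \<open>K\<close> works, the pairs violating the bound with
  \<open>K = n\<close> accumulate at a pair \<open>l\<close>. As \<open>F\<close> is bounded on
  \<open>S\<close>, \<open>q\<close> vanishes at \<open>l\<close>, while the difference of
  \<open>F\<close> is still at least \<open>e\<close> there, against isotonicity.\<close>

lemma quasimetric_affine_modulus:
  fixes q :: "'a::metric_space \<Rightarrow> 'a \<Rightarrow> real" and F :: "'a \<Rightarrow> real"
  assumes S: "compact S" and F: "continuous_on S F"
    and q_nonneg: "\<And>z w. 0 \<le> q z w"
    and q_cont: "continuous_on UNIV (\<lambda>(z, w). q z w)"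
    and iso: "\<And>z w. \<lbrakk>z \<in> S; w \<in> S; q z w = 0\<rbrakk> \<Longrightarrow> F w \<le> F z"
    and "0 < e"
  shows "\<exists>K\<ge>0. \<forall>z\<in>S. \<forall>w\<in>S. F w - F z \<le> e + K * q z w"
proof (rule ccontr)
  assume contra: "\<not> ?thesis"
  have "\<exists>p. p \<in> S \<times> S \<and> F (snd p) - F (fst p) > e + real n * q (fst p) (snd p)" for n
  proof -
    obtain z w where "z \<in> S" "w \<in> S" "F w - F z > e + real n * q z w"
      using contra[unfolded not_ex, rule_format, of "real n"] by (auto simp: not_le)
    then show ?thesis
      by (intro exI[of _ "(z, w)"]) auto
  qed
  then obtain p where p_in: "\<And>n. p n \<in> S \<times> S"
    and p_gt: "\<And>n. F (snd (p n)) - F (fst (p n)) > e + real n * q (fst (p n)) (snd (p n))"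
    by metis
  have "compact (S \<times> S)"
    using S by (rule compact_Times[OF _ S])
  then obtain l and \<phi> :: "nat \<Rightarrow> nat"
    where l: "l \<in> S \<times> S" and \<phi>: "strict_mono \<phi>" and lim: "(p \<circ> \<phi>) \<longlonglongrightarrow> l"
    using p_in unfolding compact_def by metis
  have F_diff: "continuous_on (S \<times> S) (\<lambda>p. F (snd p) - F (fst p))"
    by (intro continuous_intros continuous_on_compose2[OF F]) auto
  have lim_F: "(\<lambda>n. F (snd (p (\<phi> n))) - F (fst (p (\<phi> n)))) \<longlonglongrightarrow> F (snd l) - F (fst l)"
    using continuous_on_tendsto_compose[OF F_diff lim l] p_in by (simp add: o_def)
  have lim_q: "(\<lambda>n. q (fst (p (\<phi> n))) (snd (p (\<phi> n)))) \<longlonglongrightarrow> q (fst l) (snd l)"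
    using continuous_on_tendsto_compose[OF q_cont lim] by (simp add: o_def case_prod_beta)
  have "bounded ((\<lambda>p. F (snd p) - F (fst p)) ` (S \<times> S))"
    using compact_continuous_image[OF F_diff \<open>compact (S \<times> S)\<close>] compact_imp_bounded by blast
  then obtain B where B: "\<And>x. x \<in> S \<times> S \<Longrightarrow> \<bar>F (snd x) - F (fst x)\<bar> \<le> B"
    unfolding bounded_iff by force
  have "q (fst l) (snd l) \<le> 0"
  proof (rule LIMSEQ_le[OF lim_q])
    show "(\<lambda>n. B / real n) \<longlonglongrightarrow> 0"
      by (rule lim_const_over_n)
    \<comment> \<open>The choice of \<open>p\<close> gives \<open>\<phi> n * q \<le> B\<close> at
      the pair \<open>p (\<phi> n)\<close>, and \<open>n \<le> \<phi> n\<close>.\<close>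
    have "q (fst (p (\<phi> n))) (snd (p (\<phi> n))) \<le> B / real n" if "n \<ge> 1" for n
    proof -
      have "real n * q (fst (p (\<phi> n))) (snd (p (\<phi> n)))
          \<le> real (\<phi> n) * q (fst (p (\<phi> n))) (snd (p (\<phi> n)))"
        using seq_suble[OF \<phi>, of n] q_nonneg by (intro mult_right_mono) auto
      also have "\<dots> \<le> B"
        using p_gt[of "\<phi> n"] B[OF p_in, of "\<phi> n"] \<open>0 < e\<close> by linarith
      finally show ?thesis
        using that by (simp add: field_simps)
    qed
    then show "\<exists>N. \<forall>n\<ge>N. q (fst (p (\<phi> n))) (snd (p (\<phi> n))) \<le> B / real n"
      by blast
  qed
  then have "q (fst l) (snd l) = 0"
    using q_nonneg[of "fst l" "snd l"] by linarith
  then have "F (snd l) \<le> F (fst l)"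
    using iso l by auto
  moreover have "e \<le> F (snd l) - F (fst l)"
  proof (rule LIMSEQ_le_const[OF lim_F])
    have "e \<le> F (snd (p (\<phi> n))) - F (fst (p (\<phi> n)))" for n
      using p_gt[of "\<phi> n"] mult_nonneg_nonneg[OF of_nat_0_le_iff q_nonneg,
          of "\<phi> n" "fst (p (\<phi> n))" "snd (p (\<phi> n))"] by linarith
    then show "\<exists>N. \<forall>n\<ge>N. e \<le> F (snd (p (\<phi> n))) - F (fst (p (\<phi> n)))"
      by blast
  qed
  ultimately show False
    using \<open>0 < e\<close> by linarith
qed

text \<open>
  A quasi-metric \<open>q\<close> induces the preorder \<open>w \<preceq> z \<longleftrightarrow> q z w = 0\<close>. For an isotone \<open>F\<close> this is the
  construction of McShane and Whitney, with \<open>q\<close> in place of a metric.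
\<close>

proposition isotone_extension:
  fixes q :: "'a::metric_space \<Rightarrow> 'a \<Rightarrow> real" and F :: "'a \<Rightarrow> real"
  assumes S: "compact S" "S \<noteq> {}" and F: "continuous_on S F"
    and q_nonneg: "\<And>z w. 0 \<le> q z w" and q_refl: "\<And>z. q z z = 0"
    and q_triangle: "\<And>x y z. q x z \<le> q x y + q y z"
    and q_cont: "continuous_on UNIV (\<lambda>(z, w). q z w)"
    and iso: "\<And>z w. \<lbrakk>z \<in> S; w \<in> S; q z w = 0\<rbrakk> \<Longrightarrow> F w \<le> F z"
  obtains G where "continuous_on UNIV G" "\<And>z. z \<in> S \<Longrightarrow> G z = F z"
    "\<And>z w. q z w = 0 \<Longrightarrow> G w \<le> G z"
    "\<And>z. \<exists>u\<in>S. \<exists>v\<in>S. F u \<le> G z \<and> G z \<le> F v"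
proof -
  have "\<exists>K\<ge>0. \<forall>z\<in>S. \<forall>w\<in>S. F w - F z \<le> e + K * q z w" if "0 < e" for e
    by (rule quasimetric_affine_modulus) (use S(1) F q_nonneg q_cont iso that in \<open>assumption | blast\<close>)+
  then have "\<forall>e\<in>{0<..}. \<exists>K. 0 \<le> K \<and> (\<forall>z\<in>S. \<forall>w\<in>S. F w - F z \<le> e + K * q z w)"
    by auto
  from bchoice[OF this] obtain K
    where "\<forall>e\<in>{0<..}. 0 \<le> K e \<and> (\<forall>z\<in>S. \<forall>w\<in>S. F w - F z \<le> e + K e * q z w)"
    by blast
  then have K: "\<And>e. 0 < e \<Longrightarrow> 0 \<le> K e"
    "\<And>e z w. \<lbrakk>0 < e; z \<in> S; w \<in> S\<rbrakk> \<Longrightarrow> F w - F z \<le> e + K e * q z w"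
    by auto
  text \<open>An infimum of affine functions is concave, hence subadditive as \<open>\<omega> 0 = 0\<close>.\<close>
  define \<omega> where "\<omega> s = (INF e\<in>{0<..}. e + K e * s)" for s
  have \<omega>_arg_nonneg: "0 \<le> e + K e * s" if "0 \<le> s" "0 < e" for s e
    using that mult_nonneg_nonneg[OF K(1)[OF that(2)] that(1)] by linarith
  have \<omega>_le: "\<omega> s \<le> e + K e * s" if "0 \<le> s" "0 < e" for s e
    unfolding \<omega>_def
  proof (rule cINF_lower)
    show "bdd_below ((\<lambda>e. e + K e * s) ` {0<..})"
      using \<omega>_arg_nonneg[OF that(1)] by (intro bdd_belowI2[of _ 0]) simp
  qed (use that in simp)
  have \<omega>_ge: "c \<le> \<omega> s" if "\<And>e. 0 < e \<Longrightarrow> c \<le> e + K e * s" for c s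
    unfolding \<omega>_def using that by (intro cINF_greatest) (auto simp: greaterThan_non_empty)
  have \<omega>_nonneg: "0 \<le> \<omega> s" if "0 \<le> s" for s
    by (rule \<omega>_ge, rule \<omega>_arg_nonneg[OF that])
  have \<omega>_0: "\<omega> 0 = 0"
  proof (rule antisym)
    show "\<omega> 0 \<le> 0"
      proof (rule field_le_epsilon)
      show "\<omega> 0 \<le> 0 + e" if "0 < e" for e
        using \<omega>_le[OF order_refl that] by simp
    qed
  qed (rule \<omega>_nonneg, rule order_refl)
  have \<omega>_mono: "\<omega> s \<le> \<omega> t" if "0 \<le> s" "s \<le> t" for s t
  proof (rule \<omega>_ge)
    fix e :: real assume "0 < e"
    then show "\<omega> s \<le> e + K e * t"
      using \<omega>_le[of s e] that mult_left_mono[OF that(2) K(1)[OF \<open>0 < e\<close>]] by linarith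
  qed
  have \<omega>_add: "\<omega> (s + t) \<le> \<omega> s + \<omega> t" if st: "0 \<le> s" "0 \<le> t" for s t
  proof -
    \<comment> \<open>Whichever of the two affine functions has the smaller slope is used on all of
      \<open>s + t\<close>. The infima over \<open>d\<close> and \<open>e\<close> are then taken one
      after the other.\<close>
    have *: "\<omega> (s + t) \<le> (d + K d * s) + (e + K e * t)" if de: "0 < d" "0 < e" for d e
    proof (cases "K d \<le> K e")
      case True
      then have "K d * t \<le> K e * t"
        using st by (intro mult_right_mono)
      then show ?thesis
        using \<omega>_le[of "s + t" d] st de by (simp add: algebra_simps)
    next
      case False
      then have "K e * s \<le> K d * s"
        using st by (intro mult_right_mono) auto
      then show ?thesis
        using \<omega>_le[of "s + t" e] st de by (simp add: algebra_simps)
    qed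
    have "\<omega> (s + t) - \<omega> t \<le> \<omega> s"
    proof (rule \<omega>_ge)
      fix d :: real assume "0 < d"
      have "\<omega> (s + t) - (d + K d * s) \<le> \<omega> t"
        using *[OF \<open>0 < d\<close>] by (intro \<omega>_ge) (simp add: algebra_simps)
      then show "\<omega> (s + t) - \<omega> t \<le> d + K d * s"
        by linarith
    qed
    then show ?thesis by linarith
  qed
  have F_le: "F w - F z \<le> \<omega> (q z w)" if "z \<in> S" "w \<in> S" for z w
    by (rule \<omega>_ge, rule K(2)[OF _ that])

  obtain u v where u: "u \<in> S" "\<And>z. z \<in> S \<Longrightarrow> F u \<le> F z" and v: "v \<in> S" "\<And>z. z \<in> S \<Longrightarrow> F z \<le> F v"
    using continuous_attains_inf[OF S F] continuous_attains_sup[OF S F] by metis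
  \<comment> \<open>\<open>F w - \<omega> (q z w)\<close> is the lowest value at \<open>z\<close>
    that the modulus \<open>\<omega>\<close> allows when the value at \<open>w\<close> is
    \<open>F w\<close>. The supremum is thus the least extension respecting this modulus.\<close>
  define H where "H z = (SUP w\<in>S. F w - \<omega> (q z w))" for z
  have H_ge: "F w - \<omega> (q z w) \<le> H z" if "w \<in> S" for z w
  proof -
    have "bdd_above ((\<lambda>w. F w - \<omega> (q z w)) ` S)"
      using v(2) \<omega>_nonneg[OF q_nonneg] by (intro bdd_aboveI2[of _ _ "F v"]) (smt (verit))
    then show ?thesis
      unfolding H_def using that by (rule cSUP_upper2[OF _ _ order_refl])
  qed
  have H_le: "H z \<le> c" if "\<And>w. w \<in> S \<Longrightarrow> F w - \<omega> (q z w) \<le> c" for z c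
    unfolding H_def using that S(2) by (intro cSUP_least) auto
  have H_eq: "H z = F z" if "z \<in> S" for z
    using H_ge[OF that, of z] F_le[OF that] by (intro antisym H_le) (auto simp: q_refl \<omega>_0 algebra_simps)
  have H_modulus: "H z \<le> H z' + \<omega> (q z' z)" for z z'
  proof (rule H_le)
    fix w assume "w \<in> S"
    have "\<omega> (q z' w) \<le> \<omega> (q z' z + q z w)"
      using q_nonneg q_triangle by (intro \<omega>_mono) auto
    also have "\<dots> \<le> \<omega> (q z' z) + \<omega> (q z w)"
      using q_nonneg by (intro \<omega>_add) auto
    finally show "F w - \<omega> (q z w) \<le> H z' + \<omega> (q z' z)"
      using H_ge[OF \<open>w \<in> S\<close>, of z'] by linarith
  qed
  have H_cont: "continuous_on UNIV H"
  proof (clarsimp simp: continuous_on_eq_continuous_at isCont_def tendsto_iff dist_real_def)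
    fix z :: 'a and e :: real assume "0 < e"
    \<comment> \<open>Chosen so that \<open>K (e/2) * d < e/2\<close>, which makes
      \<open>\<omega>\<close> less than \<open>e\<close> on \<open>[0, d)\<close>; the summand 1
      keeps the denominator positive when \<open>K (e/2) = 0\<close>.\<close>
    define d where "d = e / (2 * (K (e/2) + 1))"
    have "0 < d"
      using \<open>0 < e\<close> K(1)[of "e/2"] by (simp add: d_def)
    \<comment> \<open>Since \<open>q\<close> need not be symmetric, \<open>q z' z\<close> and
      \<open>q z z'\<close> must both be made small: each bounds \<open>H z - H z'\<close> with one
      sign.\<close>
    have "continuous_on UNIV (\<lambda>z'. (\<lambda>(z, w). q z w) (z', z))"
      "continuous_on UNIV (\<lambda>z'. (\<lambda>(z, w). q z w) (z, z'))"
      by (intro continuous_on_compose2[OF q_cont] continuous_intros subset_UNIV)+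
    then have "((\<lambda>z'. q z' z) \<longlongrightarrow> q z z) (at z)" "((\<lambda>z'. q z z') \<longlongrightarrow> q z z) (at z)"
      by (auto simp: continuous_on_def)
    then have "\<forall>\<^sub>F z' in at z. q z' z < d" "\<forall>\<^sub>F z' in at z. q z z' < d"
      using \<open>0 < d\<close> by (auto simp: q_refl intro: order_tendstoD)
    then show "\<forall>\<^sub>F z' in at z. \<bar>H z' - H z\<bar> < e"
    proof eventually_elim
      case (elim z')
      have small: "\<omega> s < e" if "0 \<le> s" "s < d" for s
      proof -
        have "K (e/2) * s \<le> K (e/2) * d"
          using that K(1)[of "e/2"] \<open>0 < e\<close> by (intro mult_left_mono) auto
        also have "\<dots> < (K (e/2) + 1) * d"
          using \<open>0 < d\<close> by simp
        also have "\<dots> = e/2"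
          using K(1)[of "e/2"] \<open>0 < e\<close> by (simp add: d_def field_simps)
        finally show ?thesis
          using \<omega>_le[of s "e/2"] that \<open>0 < e\<close> by simp
      qed
      show ?case
        using H_modulus[of z z'] H_modulus[of z' z] small[OF q_nonneg elim(1)] small[OF q_nonneg elim(2)]
        by linarith
    qed
  qed
  have H_iso: "H w \<le> H z" if "q z w = 0" for z w
    using H_modulus[of w z] that by (simp add: \<omega>_0)
  show thesis
  \<comment> \<open>\<open>H\<close> stays below the maximum \<open>F v\<close> because
    \<open>\<omega>\<close> is non-negative, but it may drop below the minimum \<open>F u\<close>
    off \<open>S\<close>. Truncation at \<open>F u\<close> keeps the range and the
    isotonicity.\<close>
  proof (rule that[of "\<lambda>z. max (F u) (H z)"])
    show "continuous_on UNIV (\<lambda>z. max (F u) (H z))"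
      using H_cont by (intro continuous_intros)
    show "max (F u) (H z) = F z" if "z \<in> S" for z
      using H_eq u that by simp
    show "max (F u) (H w) \<le> max (F u) (H z)" if "q z w = 0" for z w
      using H_iso[OF that] by auto
    have "H z \<le> F v" for z
      using v(2) \<omega>_nonneg[OF q_nonneg] by (intro H_le) (smt (verit))
    then show "\<exists>a\<in>S. \<exists>b\<in>S. F a \<le> max (F u) (H z) \<and> max (F u) (H z) \<le> F b" for z
      using u(1) v u(2)[OF v(1)] by (intro bexI[of _ u] bexI[of _ v]) auto
  qed
qed

section \<open>The interior of a Jordan curve in the real plane\<close>

text \<open>A linear isomorphism is a homeomorphism preserving boundedness, so it carries the
  bounded components of a complement to bounded components.\<close>

lemma inside_linear_image:
  fixes f :: "'a::euclidean_space \<Rightarrow> 'b::euclidean_space"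
  assumes f: "linear f" and g: "linear g" and gf: "\<And>x. g (f x) = x" and fg: "\<And>y. f (g y) = y"
  shows "inside (f ` S) = f ` inside S"
proof -
  \<comment> \<open>One inclusion for any pair of mutually inverse linear maps: the component of
    \<open>h x\<close>, pulled back by \<open>k\<close>, lies in the bounded component of
    \<open>x\<close>. Using it for \<open>f\<close> and for \<open>g\<close> gives equality.\<close>
  have sub: "h ` inside T \<subseteq> inside (h ` T)"
    if h: "linear h" and k: "linear k" and kh: "\<And>x. k (h x) = x" and hk: "\<And>y. h (k y) = y"
    for h :: "'c::euclidean_space \<Rightarrow> 'd::euclidean_space" and k T
  proof clarify
    fix x assume x: "x \<in> inside T"
    have "k ` connected_component_set (- h ` T) (h x) \<subseteq> connected_component_set (- T) x"
    proof (rule connected_component_maximal)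
      show "x \<in> k ` connected_component_set (- h ` T) (h x)"
        using x kh by (intro image_eqI[of _ _ "h x"]) (auto simp: inside_def, metis kh)
      show "connected (k ` connected_component_set (- h ` T) (h x))"
        by (intro connected_continuous_image linear_continuous_on linear_linear[THEN iffD2] k
            connected_connected_component)
      show "k ` connected_component_set (- h ` T) (h x) \<subseteq> - T"
        using connected_component_subset[of "- h ` T" "h x"] hk by (auto, metis (no_types, lifting) Compl_iff image_eqI mem_Collect_eq subsetD)
    qed
    then have "bounded (k ` connected_component_set (- h ` T) (h x))"
      using x bounded_subset by (auto simp: inside_def)
    then have "bounded (h ` k ` connected_component_set (- h ` T) (h x))"
      using h by (intro bounded_linear_image[where f = h]) (auto simp: linear_linear)
    then show "h x \<in> inside (h ` T)"
      using x kh hk by (auto simp: inside_def image_image) (metis kh)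
  qed
  have "g ` inside (f ` S) \<subseteq> inside S"
    using sub[OF g f fg gf, of "f ` S"] by (simp add: image_image gf)
  then have "inside (f ` S) \<subseteq> f ` inside S"
    by (metis fg image_eqI image_subset_iff subsetI)
  with sub[OF f g gf fg, of S] show ?thesis
    by blast
qed

text \<open>The Jordan curve theorem for \<open>complex\<close>, transported along the linear
  isomorphism with \<open>real \<times> real\<close>.\<close>

lemma jordan_curve_inside:
  assumes "jordan_curve C"
  shows "inside C \<noteq> {}" "open (inside C)" "connected (inside C)" "C \<subseteq> closure (inside C)"
proof -
  obtain c where c: "simple_path c" "pathfinish c = pathstart c" "path_image c = C"
    using assms by (auto simp: jordan_curve_def)
  define f where "f = (\<lambda>p. Complex (fst p) (snd p))"
  define g where "g = (\<lambda>z. (Re z, Im z))"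
  have f: "linear f" and g: "linear g"
    by (auto intro!: linearI simp: f_def g_def complex_eq_iff)
  have gf: "g (f p) = p" and fg: "f (g z) = z" for p z
    by (auto simp: f_def g_def)
  have inj: "inj f" "inj g"
    by (metis gf fg injI)+
  have "simple_path (f \<circ> c)" "pathfinish (f \<circ> c) = pathstart (f \<circ> c)"
    using c f inj by (auto simp: simple_path_linear_image_eq pathfinish_def pathstart_def)
  note J = Jordan_inside_outside[OF this]
  have I: "inside (path_image (f \<circ> c)) = f ` inside C"
    using inside_linear_image[OF f g gf fg, of C] c(3) by (simp add: path_image_compose)
  then have gI: "inside C = g ` inside (path_image (f \<circ> c))"
    by (simp add: image_image gf)
  show "inside C \<noteq> {}"
    using J I by auto
  show "open (inside C)"
    using c by (intro open_inside) (auto simp: closed_simple_path_image)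
  show "connected (inside C)"
    unfolding gI using J g
    by (intro connected_continuous_image linear_continuous_on) (auto simp: linear_linear)
  have "f ` C \<subseteq> closure (f ` inside C)"
    using J c(3) unfolding I by (auto simp: frontier_def path_image_compose)
  also have "\<dots> = f ` closure (inside C)"
    using f inj by (metis closure_injective_linear_image)
  finally show "C \<subseteq> closure (inside C)"
    using inj by (simp add: inj_image_subset_iff)
qed

section \<open>Monotone staircases\<close>

text \<open>The signs \<open>s, t \<in> {1, -1}\<close> are the directions of the horizontal and vertical steps.\<close>

inductive staircase :: "(real \<times> real) set \<Rightarrow> real \<Rightarrow> real \<Rightarrow> real \<times> real \<Rightarrow> real \<times> real \<Rightarrow> bool"
  for U s t p where
    refl: "p \<in> U \<Longrightarrow> staircase U s t p p"
  | horizontal: "\<lbrakk>staircase U s t p (x, y); (x', y) \<in> U; s * x \<le> s * x'\<rbrakk> \<Longrightarrow> staircase U s t p (x', y)"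
  | vertical: "\<lbrakk>staircase U s t p (x, y); (x, y') \<in> U; t * y \<le> t * y'\<rbrakk> \<Longrightarrow> staircase U s t p (x, y')"

lemma staircase_in:
  "staircase U s t p q \<Longrightarrow> p \<in> U" "staircase U s t p q \<Longrightarrow> q \<in> U"
  by (induction rule: staircase.induct) auto

lemma staircase_le:
  "staircase U s t p q \<Longrightarrow> s * fst p \<le> s * fst q \<and> t * snd p \<le> t * snd q"
  by (induction rule: staircase.induct) auto

lemma staircase_swap:
  "staircase U s t p q \<Longrightarrow> staircase (prod.swap ` U) t s (prod.swap p) (prod.swap q)"
proof (induction rule: staircase.induct)
  case (horizontal x y x')
  then show ?case
    by (auto intro: staircase.vertical)
next
  case (vertical x y y')
  then show ?case
    by (auto intro: staircase.horizontal)
qed (auto intro: staircase.refl)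

text \<open>Multiplication by \<open>s = -1\<close> reverses the order, so one inequality treats
  both directions of a step.\<close>

lemma is_interval_between_signed:
  fixes X :: "real set"
  assumes "is_interval X" "s \<in> {1, -1}" "a \<in> X" "b \<in> X" "s * a \<le> s * z" "s * z \<le> s * b"
  shows "z \<in> X"
proof (cases "s = 1")
  case True
  then show ?thesis
    using mem_is_interval_1_I[OF assms(1,3,4), of z] assms by simp
next
  case False
  then show ?thesis
    using mem_is_interval_1_I[OF assms(1,4,3), of z] assms by simp
qed

text \<open>A staircase meets every column between its end points, at a height not beyond its final
  one in the direction \<open>t\<close>. A horizontal step passing over \<open>b\<close> can be
  stopped at \<open>b\<close>, since rows of \<open>U\<close> are intervals; otherwise the crossing
  occurs earlier, and later vertical steps only weaken the bound.\<close>

lemma staircase_column: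
  assumes "staircase U s t p q" and "s \<in> {1, -1}" and hconv: "\<And>y. is_interval {x. (x, y) \<in> U}"
    and "s * fst p \<le> s * b" "s * b \<le> s * fst q"
  shows "\<exists>y. staircase U s t p (b, y) \<and> t * y \<le> t * snd q"
  using assms(1,4,5)
proof (induction rule: staircase.induct)
  case refl
  then have "b = fst p"
    using \<open>s \<in> {1, -1}\<close> by auto
  then show ?case
    using refl(1) by (intro exI[of _ "snd p"]) (auto intro: staircase.refl)
next
  case (horizontal x y x')
  show ?case
  proof (cases "s * b \<le> s * x")
    case True
    then show ?thesis
      using horizontal by auto
  next
    case False
    then have "(b, y) \<in> U"
      using is_interval_between_signed[OF hconv[of y] \<open>s \<in> {1, -1}\<close>, of x x' b]
        staircase_in(2)[OF horizontal(1)] horizontal by simp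
    then show ?thesis
      using horizontal(1) False by (auto intro!: exI[of _ y] staircase.horizontal[of U s t p x y])
  qed
next
  case (vertical x y y')
  then obtain z where "staircase U s t p (b, z)" "t * z \<le> t * y"
    by auto
  then show ?case
    using \<open>t * y \<le> t * y'\<close> by (intro exI[of _ z]) auto
qed

text \<open>
  If the move goes back against \<open>s\<close>, it is absorbed where the staircase crosses the column of \<open>b\<close>;
  if it passes \<open>p\<close>, a two-step staircase through the column of \<open>p\<close> replaces the given one.
\<close>

lemma staircase_horizontal_move:
  assumes st: "staircase U s t p (x, y)" and "(b, y) \<in> U" and s: "s \<in> {1, -1}"
    and hconv: "\<And>y. is_interval {x. (x, y) \<in> U}"
  shows "staircase U s t p (b, y) \<or> staircase U (-s) t p (b, y)"
proof -
  consider "s * x \<le> s * b" | "s * fst p \<le> s * b" "s * b \<le> s * x" | "s * b \<le> s * fst p" "s * fst p \<le> s * x"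
    using staircase_le[OF st] by force
  then show ?thesis
  proof cases
    case 1
    then show ?thesis
      using st \<open>(b, y) \<in> U\<close> by (auto intro: staircase.horizontal)
  next
    case 2
    then obtain z where "staircase U s t p (b, z)" "t * z \<le> t * y"
      using staircase_column[OF st s hconv] by auto
    then show ?thesis
      using \<open>(b, y) \<in> U\<close> staircase.vertical by blast
  next
    case 3
    then have "(fst p, y) \<in> U"
      using is_interval_between_signed[OF hconv[of y] s, of b x "fst p"]
        staircase_in(2)[OF st] \<open>(b, y) \<in> U\<close> by simp
    moreover have start: "staircase U (-s) t p (fst p, snd p)"
      using staircase_in(1)[OF st] by (simp add: staircase.refl)
    ultimately have "staircase U (-s) t p (fst p, y)"
      using staircase_le[OF st] by (intro staircase.vertical[OF start]) auto
    then show ?thesis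
      using 3 \<open>(b, y) \<in> U\<close> by (auto intro!: staircase.horizontal[of U "-s" t p "fst p" y])
  qed
qed

text \<open>The horizontal case, reflected in the diagonal.\<close>

lemma staircase_vertical_move:
  assumes st: "staircase U s t p (x, y)" and "(x, b) \<in> U" and t: "t \<in> {1, -1}"
    and vconv: "\<And>x. is_interval {y. (x, y) \<in> U}"
  shows "staircase U s t p (x, b) \<or> staircase U s (-t) p (x, b)"
proof -
  have "staircase (prod.swap ` U) t s (prod.swap p) (y, x)"
    using staircase_swap[OF st] by simp
  moreover have "(b, x) \<in> prod.swap ` U"
    using \<open>(x, b) \<in> U\<close> by force
  moreover have "is_interval {x. (x, y) \<in> prod.swap ` U}" for y
  proof -
    have "{x. (x, y) \<in> prod.swap ` U} = {z. (y, z) \<in> U}"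
      by force
    then show ?thesis
      using vconv by simp
  qed
  ultimately have "staircase (prod.swap ` U) t s (prod.swap p) (b, x)
      \<or> staircase (prod.swap ` U) (-t) s (prod.swap p) (b, x)"
    using t by (rule_tac staircase_horizontal_move)
  then show ?thesis
    using staircase_swap[of "prod.swap ` U" _ s "prod.swap p" "(b, x)"] by (force simp: image_image)
qed

text \<open>Being reachable from \<open>p\<close> by a staircase with some choice of signs is
  locally constant on \<open>U\<close>, hence constant by connectedness.\<close>

lemma staircase_connected:
  assumes U: "open U" "connected U"
    and hconv: "\<And>y. is_interval {x. (x, y) \<in> U}" and vconv: "\<And>x. is_interval {y. (x, y) \<in> U}"
    and "p \<in> U" "q \<in> U"
  shows "\<exists>s\<in>{1, -1}. \<exists>t\<in>{1, -1}. staircase U s t p q"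
proof -
  define R where "R z \<longleftrightarrow> (\<exists>s\<in>{1, -1}. \<exists>t\<in>{1, -1}. staircase U s t p z)" for z
  have "R p"
    using \<open>p \<in> U\<close> by (auto simp: R_def intro: staircase.refl)
  have "R q"
    using U(2) \<open>p \<in> U\<close> \<open>q \<in> U\<close> \<open>R p\<close>
  proof (rule connected_induction_simple)
    fix a assume "a \<in> U"
    \<comment> \<open>A box in \<open>U\<close> also contains the corner
      \<open>(fst z', snd z)\<close>, so \<open>z'\<close> is reached from \<open>z\<close> by one
      horizontal and one vertical move; each changes at most one sign.\<close>
    then obtain A B where AB: "open A" "open B" "a \<in> A \<times> B" "A \<times> B \<subseteq> U"
      using U(1) unfolding open_prod_def by metis
    have "R z'" if z: "z \<in> A \<times> B" "z' \<in> A \<times> B" "R z" for z z'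
    proof -
      obtain s t where s: "s \<in> {1, -1}" and t: "t \<in> {1, -1}" and st: "staircase U s t p (fst z, snd z)"
        using z(3) unfolding R_def prod.collapse by blast
      have "(fst z', snd z) \<in> U" "(fst z', snd z') \<in> U"
        using z(1,2) AB(4) by (auto simp: mem_Times_iff)
      note in_U = this
      obtain s' where s': "s' \<in> {1, -1}" "staircase U s' t p (fst z', snd z)"
        using staircase_horizontal_move[OF st in_U(1) s hconv] s by force
      obtain t' where "t' \<in> {1, -1}" "staircase U s' t' p (fst z', snd z')"
        using staircase_vertical_move[OF s'(2) in_U(2) t vconv] t by force
      then show ?thesis
        using s'(1) unfolding R_def prod.collapse by blast
    qed
    moreover have "openin (top_of_set U) (A \<times> B)"
      using AB U by (simp add: openin_open_eq open_Times)
    ultimately show "\<exists>T. openin (top_of_set U) T \<and> a \<in> T \<and> (\<forall>z\<in>T. \<forall>z'\<in>T. R z \<longrightarrow> R z')"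
      using AB(3) by blast
  qed
  then show ?thesis
    by (simp add: R_def)
qed

section \<open>From sectionwise monotonicity to isotonicity\<close>

text \<open>With these signs every step goes left or up, and neither lets \<open>F\<close>
  decrease.\<close>

lemma staircase_monotone:
  assumes "staircase U (-1) 1 p q" "U \<subseteq> \<Omega>" "monotone_fst (\<ge>) \<Omega> F" "monotone_snd (\<le>) \<Omega> F"
  shows "F p \<le> F q"
  using assms(1)
proof (induction rule: staircase.induct)
  case (horizontal x y x')
  then have "F (x, y) \<le> F (x', y)"
    using assms(2,3) staircase_in(2)[OF horizontal(1)] unfolding monotone_fst_def monotone_on_def by auto
  then show ?case
    using horizontal by simp
next
  case (vertical x y y')
  then have "F (x, y) \<le> F (x, y')"
    using assms(2,4) staircase_in(2)[OF vertical(1)] unfolding monotone_snd_def monotone_on_def by auto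
  then show ?case
    using vertical by simp
qed simp

text \<open>When both coordinates differ strictly, approximating points of \<open>U\<close>
  eventually satisfy the same strict inequalities, which force the signs \<open>-1\<close> and
  \<open>1\<close> of the staircase joining them. An equality of coordinates could be lost in the
  approximation, but then \<open>p\<close> and \<open>q\<close> lie on a common section.\<close>

lemma sectionwise_monotone_imp_monotone:
  assumes U: "open U" "connected U" "U \<subseteq> \<Omega>" "\<Omega> \<subseteq> closure U"
    and hconv: "\<And>y. is_interval {x. (x, y) \<in> U}" and vconv: "\<And>x. is_interval {y. (x, y) \<in> U}"
    and F: "continuous_on \<Omega> F" "monotone_fst (\<ge>) \<Omega> F" "monotone_snd (\<le>) \<Omega> F"
    and pq: "p \<in> \<Omega>" "q \<in> \<Omega>" "fst q \<le> fst p" "snd p \<le> snd q"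
  shows "F p \<le> F q"
proof -
  consider "snd p = snd q" | "fst p = fst q" | "fst q < fst p" "snd p < snd q"
    using pq by force
  then show ?thesis
  proof cases
    case 1
    then show ?thesis
      using F(2) pq unfolding monotone_fst_def monotone_on_def
      by (metis (mono_tags, lifting) mem_Collect_eq prod.collapse)
  next
    case 2
    then show ?thesis
      using F(3) pq unfolding monotone_snd_def monotone_on_def
      by (metis (mono_tags, lifting) mem_Collect_eq prod.collapse)
  next
    case 3
    obtain P Q where P: "\<And>n. P n \<in> U" "P \<longlonglongrightarrow> p" and Q: "\<And>n. Q n \<in> U" "Q \<longlonglongrightarrow> q"
      using subsetD[OF U(4) pq(1)] subsetD[OF U(4) pq(2)] by (auto simp: closure_sequential)
    have "(\<lambda>n. fst (P n) - fst (Q n)) \<longlonglongrightarrow> fst p - fst q" "(\<lambda>n. snd (Q n) - snd (P n)) \<longlonglongrightarrow> snd q - snd p"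
      using P Q by (auto intro!: tendsto_intros)
    from this[THEN order_tendstoD(1), of 0]
    have "\<forall>\<^sub>F n in sequentially. 0 < fst (P n) - fst (Q n)"
      "\<forall>\<^sub>F n in sequentially. 0 < snd (Q n) - snd (P n)"
      using 3 by simp_all
    then have "\<forall>\<^sub>F n in sequentially. F (P n) \<le> F (Q n)"
    proof eventually_elim
      case (elim n)
      obtain s t where st: "s \<in> {1, -1}" "t \<in> {1, -1}" "staircase U s t (P n) (Q n)"
        using staircase_connected[OF U(1,2) hconv vconv P(1) Q(1)] by blast
      then have "s = -1" "t = 1"
        using staircase_le[OF st(3)] elim by auto
      then show ?case
        using staircase_monotone[OF _ U(3) F(2,3)] st(3) by blast
    qed
    moreover have "(\<lambda>n. F (P n)) \<longlonglongrightarrow> F p" "(\<lambda>n. F (Q n)) \<longlonglongrightarrow> F q"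
      using P Q U(3) pq by (auto intro!: continuous_on_tendsto_compose[OF F(1)] always_eventually)
    ultimately show ?thesis
      by (intro tendsto_le[OF sequentially_bot]) auto
  qed
qed

section \<open>Sections of semi-convex regions\<close>

text \<open>A missing point would lie in a gap of the segment whose two ends are frontier points.
  The ray from the first end into the gap leaves \<open>\<Omega>\<close> at once and meets the
  frontier again at the second end.\<close>

lemma semi_convex_segment:
  assumes "closed \<Omega>" "semi_convex \<Omega>" and d: "d \<in> {(1, 0), (0, 1)}"
    and p: "p \<in> \<Omega>" "p + L *\<^sub>R d \<in> \<Omega>" and c: "0 \<le> c" "c \<le> L"
  shows "p + c *\<^sub>R d \<in> \<Omega>"
proof (rule ccontr)
  assume nin: "p + c *\<^sub>R d \<notin> \<Omega>"
  define g where "g s = p + s *\<^sub>R d" for s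
  have g_cont: "continuous_on X g" for X
    unfolding g_def by (intro continuous_intros)
  have "closed (g -` \<Omega>)"
    using continuous_closed_vimage[OF \<open>closed \<Omega>\<close>] g_cont continuous_on_eq_continuous_at by blast
  then have cpt: "compact ({0..c} \<inter> g -` \<Omega>)" "compact ({c..L} \<inter> g -` \<Omega>)"
    by auto
  have "0 \<in> {0..c} \<inter> g -` \<Omega>" "L \<in> {c..L} \<inter> g -` \<Omega>"
    using p c by (auto simp: g_def)
  then have "{0..c} \<inter> g -` \<Omega> \<noteq> {}" "{c..L} \<inter> g -` \<Omega> \<noteq> {}"
    by blast+
  \<comment> \<open>\<open>u\<close> is the last parameter before \<open>c\<close>, and
    \<open>v\<close> the first after it, at which the line is in \<open>\<Omega>\<close>.\<close>
  then obtain u v where u: "u \<in> {0..c} \<inter> g -` \<Omega>" "\<forall>s\<in>{0..c} \<inter> g -` \<Omega>. s \<le> u"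
    and v: "v \<in> {c..L} \<inter> g -` \<Omega>" "\<forall>s\<in>{c..L} \<inter> g -` \<Omega>. v \<le> s"
    using compact_attains_sup[OF cpt(1)] compact_attains_inf[OF cpt(2)] by blast
  have "u \<noteq> c" "v \<noteq> c"
    using u v nin by (auto simp: g_def)
  then have "u < c" "c < v"
    using u v by auto
  have gap: "g s \<notin> \<Omega>" if "u < s" "s < v" for s
  proof
    assume "g s \<in> \<Omega>"
    have "\<not> s \<le> u" "\<not> v \<le> s"
      using that by auto
    then have "s \<notin> {0..c} \<inter> g -` \<Omega>" "s \<notin> {c..L} \<inter> g -` \<Omega>"
      using u(2) v(2) by blast+
    then show False
      using u(1) v(1) that \<open>g s \<in> \<Omega>\<close> by auto
  qed
  have "g ` {u<..<v} \<subseteq> - \<Omega>"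
    using gap by auto
  \<comment> \<open>By continuity the ends of the gap are limits of points outside
    \<open>\<Omega>\<close>, hence on the frontier.\<close>
  then have "g ` closure {u<..<v} \<subseteq> closure (- \<Omega>)"
    by (rule image_closure_subset[OF g_cont closed_closure order_trans[OF _ closure_subset]])
  moreover have "closure {u<..<v} = {u..v}"
    using \<open>u < c\<close> \<open>c < v\<close> by simp
  ultimately have "g u \<in> frontier \<Omega>" "g v \<in> frontier \<Omega>"
    using u v \<open>u < c\<close> \<open>c < v\<close> closure_subset[of \<Omega>] by (auto simp: frontier_closures)
  moreover have "\<exists>\<epsilon>>0. \<forall>t. 0 < t \<and> t < \<epsilon> \<longrightarrow> g u + t *\<^sub>R d \<notin> \<Omega>"
    using gap \<open>u < c\<close> \<open>c < v\<close> by (intro exI[of _ "v - u"]) (auto simp: g_def add.assoc simp flip: scaleR_add_left)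
  ultimately have "\<forall>t>0. g u + t *\<^sub>R d \<notin> frontier \<Omega>"
    using \<open>semi_convex \<Omega>\<close> d unfolding semi_convex_def by blast
  from this[rule_format, of "v - u"] show False
    using \<open>g v \<in> frontier \<Omega>\<close> \<open>u < c\<close> \<open>c < v\<close> by (simp add: g_def add.assoc flip: scaleR_add_left)
qed

text \<open>A small translation of the segment keeps both end points in \<open>\<Omega>\<close>, so
  the whole translated segment lies in \<open>\<Omega>\<close>.\<close>

lemma semi_convex_interior_segment:
  assumes "closed \<Omega>" "semi_convex \<Omega>" and d: "d \<in> {(1, 0), (0, 1)}"
    and p: "p \<in> interior \<Omega>" "p + L *\<^sub>R d \<in> interior \<Omega>" and c: "0 \<le> c" "c \<le> L"
  shows "p + c *\<^sub>R d \<in> interior \<Omega>"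
proof -
  obtain e1 e2 where e: "0 < e1" "ball p e1 \<subseteq> \<Omega>" "0 < e2" "ball (p + L *\<^sub>R d) e2 \<subseteq> \<Omega>"
    using p by (auto simp: mem_interior)
  have "ball (p + c *\<^sub>R d) (min e1 e2) \<subseteq> \<Omega>"
  proof
    fix w assume w: "w \<in> ball (p + c *\<^sub>R d) (min e1 e2)"
    have "w - c *\<^sub>R d \<in> ball p e1" "w - c *\<^sub>R d + L *\<^sub>R d \<in> ball (p + L *\<^sub>R d) e2"
      using w by (auto simp: dist_norm algebra_simps)
    then have "w - c *\<^sub>R d \<in> \<Omega>" "w - c *\<^sub>R d + L *\<^sub>R d \<in> \<Omega>"
      using e by blast+
    then show "w \<in> \<Omega>"
      using semi_convex_segment[OF assms(1-3), of "w - c *\<^sub>R d" L c] c by simp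
  qed
  then show ?thesis
    using e by (auto simp: mem_interior intro!: exI[of _ "min e1 e2"])
qed


theorem theorem2p2:
  fixes \<Omega> :: "(real \<times> real) set"
    and F :: "real \<times> real \<Rightarrow> real"
    and r :: "real \<Rightarrow> real \<times> real"
    and f' :: "real \<Rightarrow> real"
  assumes "compact \<Omega>"
    and "closed_jordan_region \<Omega>"
    and "semi_convex \<Omega>"
    and "continuous_on \<Omega> F"
    and "monotone_fst (\<ge>) \<Omega> F"
    and "monotone_snd (\<le>) \<Omega> F"
    and "simple_path r" and "pathfinish r = pathstart r"
    and "path_image r = frontier \<Omega>"
    and "counterclockwise r"
    and "piecewise_regular r"
    and "\<And>t. t \<in> {0..1} \<Longrightarrow> ((F \<circ> r) has_real_derivative f' t) (at t within {0..1})"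
    and "finite {t \<in> {0..1}. f' t = 0}"
  shows "\<exists>a b c d. \<Omega> \<subset> {a..b} \<times> {c..d} \<and>
           (\<exists>G. nice_extension (\<ge>) (\<le>) \<Omega> F ({a..b} \<times> {c..d}) G)"
proof -
  have jordan: "jordan_curve (frontier \<Omega>)" and \<Omega>: "\<Omega> = frontier \<Omega> \<union> inside (frontier \<Omega>)"
    using assms(2) by (auto simp: closed_jordan_region_def)
  have "closed \<Omega>"
    using assms(1) by (rule compact_imp_closed)
  have "frontier \<Omega> \<inter> inside (frontier \<Omega>) = {}"
    using inside_no_overlap by blast
  then have U: "interior \<Omega> = inside (frontier \<Omega>)"
    using \<Omega> \<open>closed \<Omega>\<close> interior_subset[of \<Omega>] by (auto simp: frontier_def)
  note J = jordan_curve_inside[OF jordan, folded U]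
  have dense: "\<Omega> \<subseteq> closure (interior \<Omega>)"
    using \<Omega> J(4) closure_subset[of "interior \<Omega>"] unfolding U by blast
  have "(x, y) \<in> interior \<Omega>"
    if "(a, y) \<in> interior \<Omega>" "(b, y) \<in> interior \<Omega>" "a \<le> x" "x \<le> b" for a b x y
    using that semi_convex_interior_segment[OF \<open>closed \<Omega>\<close> assms(3), of "(1, 0)" "(a, y)" "b - a" "x - a"] by simp
  then have hconv: "is_interval {x. (x, y) \<in> interior \<Omega>}" for y
    unfolding is_interval_1 by blast
  have "(x, y) \<in> interior \<Omega>"
    if "(x, a) \<in> interior \<Omega>" "(x, b) \<in> interior \<Omega>" "a \<le> y" "y \<le> b" for a b x y
    using that semi_convex_interior_segment[OF \<open>closed \<Omega>\<close> assms(3), of "(0, 1)" "(x, a)" "b - a" "y - a"] by simp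
  then have vconv: "is_interval {y. (x, y) \<in> interior \<Omega>}" for x
    unfolding is_interval_1 by blast
  have mono: "F p \<le> F q" if "p \<in> \<Omega>" "q \<in> \<Omega>" "fst q \<le> fst p" "snd p \<le> snd q" for p q
    using J(2,3) interior_subset dense hconv vconv assms(4-6) that
    by (rule sectionwise_monotone_imp_monotone)

  \<comment> \<open>The amount by which \<open>w\<close> lies to the left of \<open>z\<close> plus
    the amount by which it lies above \<open>z\<close>. It vanishes exactly when \<open>w\<close> is
    weakly to the right of and below \<open>z\<close>, where \<open>F w \<le> F z\<close> by
    \<open>mono\<close>.\<close>
  define q :: "real \<times> real \<Rightarrow> real \<times> real \<Rightarrow> real"
    where "q z w = max 0 (fst z - fst w) + max 0 (snd w - snd z)" for z w
  have q0: "q z w = 0 \<longleftrightarrow> fst z \<le> fst w \<and> snd w \<le> snd z" for z w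
    by (auto simp: q_def max_def)
  have "\<Omega> \<noteq> {}"
    using J(1) by auto
  obtain G where G: "continuous_on UNIV G" "\<And>z. z \<in> \<Omega> \<Longrightarrow> G z = F z"
    "\<And>z w. q z w = 0 \<Longrightarrow> G w \<le> G z"
    "\<And>z. \<exists>u\<in>\<Omega>. \<exists>v\<in>\<Omega>. F u \<le> G z \<and> G z \<le> F v"
  proof (rule isotone_extension[OF assms(1) \<open>\<Omega> \<noteq> {}\<close> assms(4), of q])
    show "0 \<le> q z w" "q z z = 0" for z w
      by (auto simp: q_def)
    show "q x z \<le> q x y + q y z" for x y z
      by (auto simp: q_def max_def)
    show "continuous_on UNIV (\<lambda>(z, w). q z w)"
      unfolding q_def case_prod_beta by (intro continuous_intros)
    show "F w \<le> F z" if "z \<in> \<Omega>" "w \<in> \<Omega>" "q z w = 0" for z w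
      using mono[of w z] that by (simp add: q0)
  qed blast
  \<comment> \<open>\<open>F\<close> maps the connected set \<open>\<Omega>\<close> onto an
    interval, so a value of \<open>G\<close> between two values of \<open>F\<close> is itself a
    value of \<open>F\<close>.\<close>
  have "connected (F ` \<Omega>)"
    using connected_intermediate_closure[OF J(3) interior_subset dense] assms(4)
    by (rule_tac connected_continuous_image)
  then have range: "G z \<in> F ` \<Omega>" for z
    using G(4)[of z] connectedD_interval[of "F ` \<Omega>"] by blast

  obtain B where B: "\<And>z. z \<in> \<Omega> \<Longrightarrow> norm z \<le> B"
    using compact_imp_bounded[OF assms(1)] by (auto simp: bounded_iff)
  \<comment> \<open>As \<open>b\<close> exceeds every norm in \<open>\<Omega>\<close>, the corner
    \<open>(b, b)\<close> is outside \<open>\<Omega>\<close> and the inclusion in the square is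
    strict.\<close>
  define b where "b = \<bar>B\<bar> + 1"
  define D where "D = {-b..b} \<times> {-b..b}"
  have "\<bar>fst z\<bar> < b \<and> \<bar>snd z\<bar> < b" if "z \<in> \<Omega>" for z
    using B[OF that] norm_fst_le[of "fst z" "snd z"] norm_snd_le[of "snd z" "fst z"] by (simp add: b_def)
  then have "\<Omega> \<subseteq> D" "(b, b) \<notin> \<Omega>"
    by (force simp: D_def mem_Times_iff)+
  then have "\<Omega> \<subset> D"
    by (auto simp: D_def b_def)
  moreover have "nice_extension (\<ge>) (\<le>) \<Omega> F D G"
    unfolding nice_extension_def monotone_extension_def
  proof (intro conjI ballI)
    show "continuous_on D G"
      using G(1) continuous_on_subset by blast
    show "monotone_fst (\<ge>) D G" "monotone_snd (\<le>) D G"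
      unfolding monotone_fst_def monotone_snd_def by (auto intro!: monotone_onI G(3) simp: q0)
    show "G ` D = F ` \<Omega>"
      using range G(2) \<open>\<Omega> \<subseteq> D\<close> by (force simp: image_iff)
  qed (use \<open>\<Omega> \<subseteq> D\<close> G(2) in auto)
  ultimately show ?thesis
    unfolding D_def by blast
qed

end
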